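(* Let $\Phi:\mathbb{R}\to\mathbb{R}$ be a bounded, continuous and strictly increasing function, extended to $\pm\infty$ by its limits. Let $u:\mathbb{R}^n\to[-\infty,+\infty]$ be a measurable function (possibly taking the values $\pm\infty$ on a set of positive measure). Then the set $\widetilde\Sigma_u$ of points of $\mathbb{R}^n$ at which the blowup of $u$ (in the sense of the convergence associated with $\Phi$ defined in the context) exists and is not constant can be covered by countably many $(n-1)$-dimensional Lipschitz graphs.
   Context: $B_1$ is the Euclidean unit ball of $\mathbb{R}^n$ centered at the origin, and $|A|$ denotes the Lebesgue measure of $A\subset\mathbb{R}^n$. For $x\in\mathbb{R}^n$ and $r>0$ let $u^{x,r}:B_1\to[-\infty,+\infty]$, $u^{x,r}(y):=u(x+ry)$. For measurable functions $w_r$ ($r>0$) and $v$ from $B_1$ to $[-\infty,+\infty]$, we say that $w_r\to v$ in $B_1$ as $r\to0$ if for every $\varepsilon>0$ $$\lim_{r\to 0}\big|\{y\in B_1:\ |\Phi(w_r(y))-\Phi(v(y))|>\varepsilon\}\big|=0,$$ where $\Phi(\pm\infty):=\lim_{t\to\pm\infty}\Phi(t)$. With this convergence define $$\widetilde\Sigma_u:=\{x\in\mathbb{R}^n:\ u^{x,r}\to v \text{ in } B_1 \text{ as } r\to 0, \text{ for some measurable } v:B_1\to[-\infty,+\infty] \text{ not constant}\},$$ where "not constant" means not almost everywhere equal to a constant in $[-\infty,+\infty]$. An $(n-1)$-dimensional Lipschitz graph in $\mathbb{R}^n$ is a set that, up to a rotation of $\mathbb{R}^n$, is the graph $\{(t,f(t)):t\in\mathbb{R}^{n-1}\}$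 of a Lipschitz function $f:\mathbb{R}^{n-1}\to\mathbb{R}$. The covering is of the whole set, with no exceptional null set. *)

theory Defs
  imports "HOL-Analysis.Analysis"
begin

definition ext_lim :: "(real \<Rightarrow> real) \<Rightarrow> ereal \<Rightarrow> real" where
  "ext_lim \<Phi> s = (case s of ereal t \<Rightarrow> \<Phi> t | PInfty \<Rightarrow> Lim at_top \<Phi> | MInfty \<Rightarrow> Lim at_bot \<Phi>)"

definition blowup :: "(real ^ 'n \<Rightarrow> ereal) \<Rightarrow> real ^ 'n \<Rightarrow> real \<Rightarrow> real ^ 'n \<Rightarrow> ereal" where
  "blowup u x r = (\<lambda>y. u (x + r *\<^sub>R y))"

text \<open>Functions on the unit ball are total functions here; only their values on the ball
  \<open>ball 0 1\<close> matter below.\<close>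

definition converges_in_B1 ::
    "(real \<Rightarrow> real) \<Rightarrow> (real \<Rightarrow> real ^ 'n \<Rightarrow> ereal) \<Rightarrow> (real ^ 'n \<Rightarrow> ereal) \<Rightarrow> bool" where
  "converges_in_B1 \<Phi> w v \<longleftrightarrow>
     (\<forall>\<epsilon>>0. ((\<lambda>r. measure lebesgue
        {y \<in> ball 0 1. \<bar>ext_lim \<Phi> (w r y) - ext_lim \<Phi> (v y)\<bar> > \<epsilon>}) \<longlongrightarrow> 0) (at_right 0))"

definition jump_set :: "(real \<Rightarrow> real) \<Rightarrow> (real ^ 'n \<Rightarrow> ereal) \<Rightarrow> (real ^ 'n) set" where
  "jump_set \<Phi> u = {x. \<exists>v :: real ^ 'n \<Rightarrow> ereal.
     v \<in> borel_measurable (lebesgue_on (ball 0 1)) \<and>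
     converges_in_B1 \<Phi> (blowup u x) v \<and>
     \<not> (\<exists>c. AE y in lebesgue_on (ball 0 1). v y = c)}"

text \<open>The space of dimension \<open>CARD('n) - 1\<close> is realised as a coordinate hyperplane
  \<open>{t. t $ k = 0}\<close>, so that the point \<open>(t, f t)\<close> becomes \<open>t + f t *\<^sub>R axis k 1\<close>. This also covers
  \<open>CARD('n) = 1\<close>, where the hyperplane is a single point.\<close>

definition lipschitz_graph :: "(real ^ 'n) set \<Rightarrow> bool" where
  "lipschitz_graph G \<longleftrightarrow>
     (\<exists>Q k (f :: real ^ 'n \<Rightarrow> real) L.
        rotation_matrix Q \<and> L-lipschitz_on {t. t $ k = 0} f \<and>
        G = (\<lambda>p. Q *v p) ` {t + f t *\<^sub>R axis k 1 | t. t $ k = 0})"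

end

(* A nonconstant blowup limit v has a cut c such that {v < c} and {v > c} both have positive
   measure, hence each nearly fills some small ball of the unit ball. Convergence transfers
   this to u at every small scale: in a ball of radius rho about x + rho * alpha the set
   {u >= c} has density at most 1/4, and in one about x + rho * beta at least 3/4. Here
   alpha, beta and c range over countable sets. Two such points x, y cannot satisfy
   x - y = rho * (beta - alpha), even approximately, as the two kinds of balls would then nearly
   coincide. So near each of its points the set of such points avoids a cone around
   beta - alpha, which makes it locally a subset of a Lipschitz graph. No exceptional null set
   arises because the density theorem is applied to v, not to u. *)

theory Submission
  imports Defs
begin

section \<open>Density of a set of positive measure in small balls\<close>

text \<open>Otherwise at least the fraction \<open>\<epsilon>\<close> of every such ball lies
  outside \<open>A\<close>. A disjoint Vitali family of these balls fills an open neighbourhood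
  \<open>T \<inter> W\<close> of \<open>A\<close> up to a null set, so \<open>T - A\<close> has
  measure at least \<open>\<epsilon>\<close> times that of \<open>A\<close>, although
  \<open>T\<close> can be chosen closer to \<open>A\<close> than that. Centres in \<open>D\<close>
  and radii \<open>1 / m\<close> leave only countably many balls when \<open>D\<close> is
  countable.\<close>

lemma density_ball:
  fixes A W D :: "'a::euclidean_space set"
  assumes A: "A \<in> lmeasurable" "0 < measure lebesgue A" "A \<subseteq> W" and "open W"
    and D: "\<And>X. open X \<Longrightarrow> X \<noteq> {} \<Longrightarrow> \<exists>d\<in>D. d \<in> X" and "0 < \<epsilon>"
  obtains a m where "a \<in> D" "0 < (m::nat)" "ball a (1 / m) \<subseteq> W"
    "measure lebesgue (ball a (1 / m) - A) < \<epsilon> * measure lebesgue (ball a (1 / m))"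
proof (rule ccontr)
  assume neg: "\<not> thesis"
  note found = that
  let ?B = "\<lambda>i. ball (fst i) (1 / real (snd i :: nat)) :: 'a set"
  have sparse: "\<epsilon> * measure lebesgue (?B i) \<le> measure lebesgue (?B i - A)"
    if "fst i \<in> D" "0 < snd i" "?B i \<subseteq> W" for i
    using that neg found[of "fst i" "snd i"] by (force simp: not_less)
  obtain T where T: "open T" "A \<subseteq> T" "T - A \<in> lmeasurable"
    "emeasure lebesgue (T - A) < ennreal (\<epsilon> * measure lebesgue A)"
    using sets_lebesgue_outer_open[of A "\<epsilon> * measure lebesgue A"] A \<open>0 < \<epsilon>\<close> by auto
  \<comment> \<open>Confining the balls to \<open>T\<close> makes their parts outside
    \<open>A\<close> count towards \<open>T - A\<close>.\<close>
  define K where "K = {i. fst i \<in> D \<and> 0 < snd i \<and> ?B i \<subseteq> T \<inter> W}"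
  obtain C where C: "countable C" "C \<subseteq> K"
     "pairwise (\<lambda>i j. disjnt (ball (fst i) (1 / real (snd i))) (ball (fst j) (1 / real (snd j)))) C"
     "negligible (T \<inter> W - (\<Union>i \<in> C. ball (fst i) (1 / real (snd i))))"
  proof (rule Vitali_covering_theorem_balls[of "T \<inter> W" K fst "\<lambda>i. 1 / real (snd i)"])
    fix x and d :: real
    assume x: "x \<in> T \<inter> W" and "0 < d"
    obtain e where e: "0 < e" "ball x e \<subseteq> T \<inter> W"
      using x T(1) \<open>open W\<close> by (meson open_Int openE)
    \<comment> \<open>The bound \<open>e / 2\<close> leaves room to move the centre: if
      \<open>a\<close> is within \<open>1 / m\<close> of \<open>x\<close>, its ball of radius
      \<open>1 / m\<close> stays inside \<open>ball x e\<close>.\<close>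
    obtain m :: nat where m: "0 < m" "1 / real m < min d (e / 2)"
      using e \<open>0 < d\<close> by (metis half_gt_zero min_less_iff_conj nat_approx_posE zero_less_Suc)
    obtain a where a: "a \<in> D" "a \<in> ball x (1 / m)"
      using D[of "ball x (1 / m)"] m by auto
    have "ball a (1 / m) \<subseteq> ball x e"
    proof
      fix y assume "y \<in> ball a (1 / m)"
      then show "y \<in> ball x e"
        using a m dist_triangle[of x y a] by auto
    qed
    then show "\<exists>i. i \<in> K \<and> x \<in> ball (fst i) (1 / real (snd i)) \<and> 1 / real (snd i) < d"
      using a m e by (intro exI[of _ "(a, m)"]) (auto simp: K_def dist_commute)
  qed
  have disj: "disjoint_family_on ?B C"
    using C(3) by (simp add: disjoint_family_on_def pairwise_def disjnt_def)
  then have disj': "disjoint_family_on (\<lambda>i. ?B i - A) C"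
    by (rule disjoint_family_on_bisimulation) blast
  have *: "ennreal \<epsilon> * emeasure lebesgue (?B i) \<le> emeasure lebesgue (?B i - A)" if "i \<in> C" for i
  proof -
    have "?B i \<in> lmeasurable" "?B i - A \<in> lmeasurable"
      using A by (auto intro: fmeasurable.Diff)
    then show ?thesis
      using sparse[of i] that C(2) \<open>0 < \<epsilon>\<close>
      by (auto simp: K_def emeasure_eq_measure2 ennreal_mult[symmetric] intro!: ennreal_leI)
  qed
  have "ennreal (\<epsilon> * measure lebesgue A) = ennreal \<epsilon> * emeasure lebesgue A"
    using A \<open>0 < \<epsilon>\<close> by (simp add: emeasure_eq_measure2 ennreal_mult)
  also have "emeasure lebesgue A \<le> emeasure lebesgue (\<Union>i\<in>C. ?B i)"
  proof -
    have "emeasure lebesgue A \<le> emeasure lebesgue ((\<Union>i\<in>C. ?B i) \<union> (T \<inter> W - (\<Union>i\<in>C. ?B i)))"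
      using A T C \<open>open W\<close> by (intro emeasure_mono) (auto intro!: sets.Un sets.Diff)
    also have "\<dots> = emeasure lebesgue (\<Union>i\<in>C. ?B i)"
      using C by (intro emeasure_Un_null_set)
        (auto simp: negligible_iff_null_sets)
    finally show ?thesis .
  qed
  also have "ennreal \<epsilon> * emeasure lebesgue (\<Union>i\<in>C. ?B i)
      = (\<integral>\<^sup>+i. ennreal \<epsilon> * emeasure lebesgue (?B i) \<partial>count_space C)"
    by (subst emeasure_UN_countable) (use C disj in \<open>auto simp: nn_integral_cmult\<close>)
  also have "\<dots> \<le> (\<integral>\<^sup>+i. emeasure lebesgue (?B i - A) \<partial>count_space C)"
    by (intro nn_integral_mono) (use * in auto)
  also have "\<dots> = emeasure lebesgue (\<Union>i\<in>C. ?B i - A)"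
    by (subst emeasure_UN_countable) (use C disj' A in auto)
  also have "\<dots> \<le> emeasure lebesgue (T - A)"
    using C(2) T by (intro emeasure_mono) (auto simp: K_def)
  also note T(4)
  finally show False by (simp add: mult_left_mono)
qed

text \<open>The smaller concentric ball of radius \<open>(1 - \<delta>)\<rho>\<close> lies in both balls; its volume is
  estimated from below by Bernoulli's inequality.\<close>

lemma measure_Int_ball_translate:
  fixes z z' :: "'a::euclidean_space"
  defines "\<delta> \<equiv> 1 / (4 * real DIM('a))"
  assumes U: "U \<in> sets lebesgue" and "0 < \<rho>" and close: "dist z z' \<le> \<delta> * \<rho>"
  shows "measure lebesgue (U \<inter> ball z \<rho>)
    \<le> measure lebesgue (U \<inter> ball z' \<rho>) + measure lebesgue (ball (0::'a) \<rho>) / 4"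
proof -
  have "1 \<le> 4 * real DIM('a)"
    using DIM_positive[where 'a='a] by linarith
  then have \<delta>: "0 < \<delta>" "\<delta> \<le> 1"
    by (auto simp: \<delta>_def divide_le_eq_1)
  let ?R = "ball z \<rho> - ball z ((1 - \<delta>) * \<rho>)"
  have sub: "ball z ((1 - \<delta>) * \<rho>) \<subseteq> ball z' \<rho>"
  proof
    fix y assume "y \<in> ball z ((1 - \<delta>) * \<rho>)"
    then show "y \<in> ball z' \<rho>"
      using close dist_triangle[of z' y z] by (auto simp: dist_commute algebra_simps)
  qed
  have small: "ball z ((1 - \<delta>) * \<rho>) \<subseteq> ball z \<rho>"
    using \<open>0 < \<rho>\<close> \<delta> by (intro subset_ball) (simp add: mult_left_le_one_le)
  have "measure lebesgue (U \<inter> ball z \<rho>) \<le> measure lebesgue ((U \<inter> ball z' \<rho>) \<union> ?R)"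
    using sub U by (intro measure_mono_fmeasurable) (auto intro!: fmeasurable.Un fmeasurable_Int_fmeasurable[of "ball _ _" _ U, unfolded Int_commute[of _ U]] fmeasurable.Diff)
  also have "\<dots> \<le> measure lebesgue (U \<inter> ball z' \<rho>) + measure lebesgue ?R"
    using U by (intro measure_Un_le) auto
  also have "measure lebesgue ?R = measure lebesgue (ball z \<rho>) - measure lebesgue (ball z ((1 - \<delta>) * \<rho>))"
    using small by (intro measurable_measure_Diff) auto
  also have "\<dots> = measure lebesgue (ball (0::'a) \<rho>) * (1 - (1 - \<delta>) ^ DIM('a))"
    using \<delta> \<open>0 < \<rho>\<close> by (simp add: content_ball power_mult_distrib right_diff_distrib)
  also have "\<dots> \<le> measure lebesgue (ball (0::'a) \<rho>) * (1 / 4)"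
  proof (rule mult_left_mono)
    have "1 - real DIM('a) * \<delta> \<le> (1 - \<delta>) ^ DIM('a)"
      using Bernoulli_inequality[of "-\<delta>" "DIM('a)"] \<delta> by simp
    then show "1 - (1 - \<delta>) ^ DIM('a) \<le> 1 / 4"
      using DIM_positive[where 'a='a] by (simp add: \<delta>_def)
  qed simp
  finally show ?thesis by simp
qed

section \<open>Subsets of Lipschitz graphs\<close>

text \<open>In dimension one the only rotation is the identity, so \<open>\<nu>\<close> is reached only up to sign.\<close>

lemma rotation_matrix_to_axis:
  fixes \<nu> :: "real ^ 'n"
  assumes "norm \<nu> = 1"
  obtains Q where "rotation_matrix Q" "Q *v axis k 1 = \<nu> \<or> Q *v axis k 1 = - \<nu>"
proof (cases "2 \<le> CARD('n)")
  case True
  with assms show ?thesis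
    using rotation_matrix_exists_basis[of \<nu> k] that by metis
next
  case False
  then have "CARD('n) = 1"
    using zero_less_card_finite[where 'a='n] by linarith
  then have all: "i = k" for i :: 'n
    by (metis UNIV_I card_1_singletonE singletonD)
  then have "\<nu> = (\<nu> $ k) *\<^sub>R axis k 1"
    by (simp add: vec_eq_iff axis_def) (metis all)
  moreover from this assms have "\<bar>\<nu> $ k\<bar> = 1"
    by (metis mult.right_neutral norm_axis_1 norm_scaleR)
  then have "\<nu> $ k = 1 \<or> \<nu> $ k = -1" by linarith
  ultimately have "mat 1 *v axis k 1 = \<nu> \<or> mat 1 *v axis k 1 = - \<nu>"
    by (metis add.inverse_inverse matrix_vector_mul_lid scaleR_minus_left scaleR_one)
  then show ?thesis
    by (intro that[of "mat 1"]) (auto simp: rotation_matrix_def orthogonal_matrix_id)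
qed

text \<open>McShane's formula.\<close>

lemma lipschitz_on_extension:
  fixes f :: "'a::metric_space \<Rightarrow> real"
  assumes "L-lipschitz_on S f"
  obtains g where "L-lipschitz_on UNIV g" "\<And>x. x \<in> S \<Longrightarrow> g x = f x"
proof (cases "S = {}")
  case True
  then show ?thesis
    using lipschitz_on_nonneg[OF assms] by (intro that[of "\<lambda>_. 0"]) (auto intro!: lipschitz_onI)
next
  case False
  note L0 = lipschitz_on_nonneg[OF assms]
  define g where "g t = (INF p\<in>S. f p + L * dist t p)" for t
  obtain q where q: "q \<in> S" using False by auto
  have bdd: "bdd_below ((\<lambda>p. f p + L * dist t p) ` S)" for t
  proof (rule bdd_belowI2)
    fix p assume p: "p \<in> S"
    have "f q - f p \<le> L * dist q p"
      using lipschitz_onD[OF assms q p] by (auto simp: dist_real_def)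
    also have "\<dots> \<le> L * (dist t q + dist t p)"
      using dist_triangle[of q p t] L0 by (intro mult_left_mono) (auto simp: dist_commute)
    finally show "f q - L * dist t q \<le> f p + L * dist t p"
      by (simp add: algebra_simps)
  qed
  have step: "g t \<le> g t' + L * dist t t'" for t t'
  proof -
    have "g t - L * dist t t' \<le> f p + L * dist t' p" if "p \<in> S" for p
    proof -
      have "g t \<le> f p + L * dist t p"
        unfolding g_def by (rule cINF_lower[OF bdd that])
      also have "\<dots> \<le> f p + L * (dist t t' + dist t' p)"
        using dist_triangle[of t p t'] L0 by (intro add_left_mono mult_left_mono)
      finally show ?thesis by (simp add: algebra_simps)
    qed
    then have "g t - L * dist t t' \<le> g t'"
      unfolding g_def[of t'] using False by (intro cINF_greatest)
    then show ?thesis by simp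
  qed
  show ?thesis
  proof (rule that[of g])
    show "L-lipschitz_on UNIV g"
      using L0 step by (intro lipschitz_onI) (force simp: dist_real_def dist_commute abs_le_iff algebra_simps)+
    fix x assume x: "x \<in> S"
    have "g x \<le> f x"
      unfolding g_def using cINF_lower[OF bdd x, of x] by simp
    moreover have "f x \<le> g x"
      unfolding g_def
    proof (rule cINF_greatest[OF False])
      fix p assume "p \<in> S"
      then show "f x \<le> f p + L * dist x p"
        using lipschitz_onD[OF assms x, of p] by (auto simp: dist_real_def)
    qed
    ultimately show "g x = f x" by simp
  qed
qed

text \<open>The cone bound makes the component along \<open>\<nu>\<close> an
  \<open>L\<close>-Lipschitz function of the orthogonal component, so \<open>P\<close> is a graph
  over its projection. McShane's formula extends this function to the whole hyperplane.\<close>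

lemma cone_imp_subset_lipschitz_graph:
  fixes P :: "(real ^ 'n) set"
  assumes "norm \<nu> = 1" "0 \<le> L"
    and cone: "\<And>x y. x \<in> P \<Longrightarrow> y \<in> P \<Longrightarrow> \<bar>(x - y) \<bullet> \<nu>\<bar> \<le> L * norm ((x - y) - ((x - y) \<bullet> \<nu>) *\<^sub>R \<nu>)"
  shows "\<exists>G. lipschitz_graph G \<and> P \<subseteq> G"
proof -
  fix k :: 'n
  obtain Q where Q: "rotation_matrix Q" and Qk: "Q *v axis k 1 = \<nu> \<or> Q *v axis k 1 = - \<nu>"
    using rotation_matrix_to_axis[OF assms(1)] by blast
  \<comment> \<open>The rotation may reach only \<open>- \<nu>\<close>. The cone bound does not
    change when \<open>\<nu>\<close> is replaced by \<open>- \<nu>\<close>, so it holds for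
    \<open>\<mu>\<close> in either case.\<close>
  define \<mu> where "\<mu> = Q *v axis k 1"
  have \<mu>: "norm \<mu> = 1" "\<bar>(x - y) \<bullet> \<mu>\<bar> \<le> L * norm ((x - y) - ((x - y) \<bullet> \<mu>) *\<^sub>R \<mu>)"
    if "x \<in> P" "y \<in> P" for x y
    using Qk cone[OF that] assms(1) by (auto simp: \<mu>_def[symmetric])
  have orth: "orthogonal_transformation ((*v) Q)"
    using Q by (simp add: rotation_matrix_def orthogonal_transformation_matrix)
  then have inner: "(Q *v a) \<bullet> (Q *v b) = a \<bullet> b" and norm: "norm (Q *v a) = norm a" for a b
    by (auto simp: orthogonal_transformation_def norm_eq_sqrt_inner)
  define R where "R = inv ((*v) Q)"
  have QR: "Q *v R x = x" for x
    using orthogonal_transformation_surj[OF orth] by (simp add: R_def surj_f_inv_f)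
  have Rk: "R x $ k = x \<bullet> \<mu>" for x
    using inner[of "R x" "axis k 1"] by (simp add: QR \<mu>_def inner_axis)
  \<comment> \<open>Orthogonal projection along \<open>\<mu>\<close>, written in rotated
    coordinates, where its image lies in the hyperplane of vanishing \<open>k\<close>-th
    coordinate.\<close>
  define h where "h x = R x - (R x $ k) *\<^sub>R axis k 1" for x
  have hk: "h x $ k = 0" for x by (simp add: h_def)
  have Qh: "Q *v h x = x - (x \<bullet> \<mu>) *\<^sub>R \<mu>" for x
    by (simp add: h_def matrix_vector_mult_diff_distrib matrix_vector_mult_scaleR QR Rk \<mu>_def)
  have dh: "\<bar>x \<bullet> \<mu> - y \<bullet> \<mu>\<bar> \<le> L * dist (h x) (h y)" if "x \<in> P" "y \<in> P" for x y
  proof -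
    have "dist (h x) (h y) = norm (Q *v h x - Q *v h y)"
      by (metis dist_norm matrix_vector_mult_diff_distrib norm)
    also have "Q *v h x - Q *v h y = (x - y) - ((x - y) \<bullet> \<mu>) *\<^sub>R \<mu>"
      by (simp add: Qh algebra_simps)
    finally show ?thesis using \<mu>(2)[OF that] by (simp add: inner_diff_left)
  qed
  have "inj_on h P"
  proof (rule inj_onI)
    fix x y assume xy: "x \<in> P" "y \<in> P" "h x = h y"
    then have "x \<bullet> \<mu> = y \<bullet> \<mu>"
      using dh[of x y] by simp
    then show "x = y"
      using Qh xy(3) by (metis diff_add_cancel)
  qed
  define f where "f t = inv_into P h t \<bullet> \<mu>" for t
  have fh: "f (h x) = x \<bullet> \<mu>" if "x \<in> P" for x
    using \<open>inj_on h P\<close> that by (simp add: f_def)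
  have "L-lipschitz_on (h ` P) f"
    using assms(2) dh by (intro lipschitz_onI) (auto simp: fh dist_real_def)
  then obtain g where g: "L-lipschitz_on UNIV g" "\<And>t. t \<in> h ` P \<Longrightarrow> g t = f t"
    by (metis lipschitz_on_extension)
  let ?G = "(\<lambda>p. Q *v p) ` {t + g t *\<^sub>R axis k 1 | t. t $ k = 0}"
  have "lipschitz_graph ?G"
    unfolding lipschitz_graph_def using Q lipschitz_on_subset[OF g(1)] by blast
  moreover have "P \<subseteq> ?G"
  proof
    fix x assume "x \<in> P"
    then have "x = Q *v (h x + g (h x) *\<^sub>R axis k 1)"
      using Qh[of x] by (simp add: g(2) fh matrix_vector_right_distrib matrix_vector_mult_scaleR \<mu>_def)
    then show "x \<in> ?G" using hk by blast
  qed
  ultimately show ?thesis by blast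
qed

text \<open>If \<open>x - y\<close> were steep, then \<open>\<rho> *\<^sub>R w\<close> with \<open>\<rho> = \<bar>(x - y) \<bullet> \<nu>\<bar> / norm w\<close> would be close
  to \<open>x - y\<close> or to \<open>y - x\<close>.\<close>

lemma avoiding_cone_imp_subset_lipschitz_graph:
  fixes P :: "(real ^ 'n) set"
  assumes "w \<noteq> 0" "0 < \<delta>"
    and avoid: "\<And>x y \<rho>. x \<in> P \<Longrightarrow> y \<in> P \<Longrightarrow> 0 < \<rho> \<Longrightarrow> \<delta> * \<rho> < norm (x - y - \<rho> *\<^sub>R w)"
  shows "\<exists>G. lipschitz_graph G \<and> P \<subseteq> G"
proof (rule cone_imp_subset_lipschitz_graph)
  define \<nu> where "\<nu> = w /\<^sub>R norm w"
  show "norm (w /\<^sub>R norm w) = 1" using assms(1) by simp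
  show "0 \<le> norm w / \<delta>" using assms by simp
  \<comment> \<open>Only a positive component gives an admissible \<open>\<rho>\<close>; otherwise
    the one-sided bound is trivial. Exchanging \<open>x\<close> and \<open>y\<close> then yields the
    absolute value.\<close>
  have one: "(x - y) \<bullet> \<nu> \<le> norm w / \<delta> * norm ((x - y) - ((x - y) \<bullet> \<nu>) *\<^sub>R \<nu>)"
    if "x \<in> P" "y \<in> P" for x y
  proof (cases "0 < (x - y) \<bullet> \<nu>")
    case True
    then show ?thesis
      using avoid[OF that, of "(x - y) \<bullet> \<nu> / norm w"] assms
      by (simp add: \<nu>_def divide_simps mult_ac)
  next
    case False
    have "0 \<le> norm w / \<delta> * norm ((x - y) - ((x - y) \<bullet> \<nu>) *\<^sub>R \<nu>)" using assms by simp
    with False show ?thesis by linarith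
  qed
  fix x y assume "x \<in> P" "y \<in> P"
  then have "(x - y) \<bullet> \<nu> \<le> norm w / \<delta> * norm ((x - y) - ((x - y) \<bullet> \<nu>) *\<^sub>R \<nu>)"
    "(y - x) \<bullet> \<nu> \<le> norm w / \<delta> * norm ((y - x) - ((y - x) \<bullet> \<nu>) *\<^sub>R \<nu>)"
    using one by auto
  moreover have "(y - x) - ((y - x) \<bullet> \<nu>) *\<^sub>R \<nu> = - ((x - y) - ((x - y) \<bullet> \<nu>) *\<^sub>R \<nu>)"
    by (simp add: inner_diff_left algebra_simps)
  then have "norm ((y - x) - ((y - x) \<bullet> \<nu>) *\<^sub>R \<nu>) = norm ((x - y) - ((x - y) \<bullet> \<nu>) *\<^sub>R \<nu>)"
    by (simp only: norm_minus_cancel)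
  moreover have "(y - x) \<bullet> \<nu> = - ((x - y) \<bullet> \<nu>)"
    by (simp add: inner_diff_left)
  ultimately show "\<bar>(x - y) \<bullet> (w /\<^sub>R norm w)\<bar>
      \<le> norm w / \<delta> * norm ((x - y) - ((x - y) \<bullet> (w /\<^sub>R norm w)) *\<^sub>R (w /\<^sub>R norm w))"
    unfolding \<nu>_def[symmetric] abs_le_iff by simp
qed

section \<open>Extension of \<Phi> to infinite values, and cuts of nonconstant functions\<close>

lemma ext_lim_measurable [measurable]:
  assumes "continuous_on UNIV \<Phi>"
  shows "ext_lim \<Phi> \<in> borel_measurable borel"
proof -
  have [measurable]: "\<Phi> \<in> borel_measurable borel"
    using assms by (rule borel_measurable_continuous_onI)
  have "ext_lim \<Phi> = (\<lambda>s. if s = \<infinity> then Lim at_top \<Phi> else if s = -\<infinity> then Lim at_bot \<Phi> else \<Phi> (real_of_ereal s))"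
    by (rule ext) (auto simp: ext_lim_def split: ereal.split)
  then show ?thesis by simp
qed

text \<open>\<open>Lim\<close> carries information only once convergence is known. Monotonicity and
  boundedness provide it, the limits being the supremum and infimum of the range, and these bracket
  every finite value.\<close>

lemma ext_lim_mono:
  assumes "bounded (range \<Phi>)" "mono \<Phi>"
  shows "mono (ext_lim \<Phi>)"
proof (rule monoI)
  have bdd: "bdd_above (range \<Phi>)" "bdd_below (range \<Phi>)"
    using assms(1) by (auto intro: bounded_imp_bdd_above bounded_imp_bdd_below)
  have "(\<Phi> \<longlongrightarrow> (SUP t. \<Phi> t)) at_top"
  proof (rule increasing_tendsto)
    show "\<forall>\<^sub>F t in at_top. \<Phi> t \<le> (SUP t. \<Phi> t)"
      using bdd by (simp add: cSUP_upper)
    fix z assume "z < (SUP t. \<Phi> t)"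
    then obtain s where "z < \<Phi> s" using less_cSUP_iff[OF _ bdd(1)] by auto
    then show "\<forall>\<^sub>F t in at_top. z < \<Phi> t"
      using assms(2) by (auto simp: eventually_at_top_linorder mono_def intro: less_le_trans)
  qed
  then have top: "Lim at_top \<Phi> = (SUP t. \<Phi> t)"
    by (intro tendsto_Lim) auto
  have "(\<Phi> \<longlongrightarrow> (INF t. \<Phi> t)) at_bot"
  proof (rule decreasing_tendsto)
    show "\<forall>\<^sub>F t in at_bot. (INF t. \<Phi> t) \<le> \<Phi> t"
      using bdd by (simp add: cINF_lower)
    fix z assume "(INF t. \<Phi> t) < z"
    then obtain s where "\<Phi> s < z" using cINF_less_iff[OF _ bdd(2)] by auto
    then show "\<forall>\<^sub>F t in at_bot. \<Phi> t < z"
      using assms(2) by (auto simp: eventually_at_bot_linorder mono_def intro: le_less_trans)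
  qed
  then have bot: "Lim at_bot \<Phi> = (INF t. \<Phi> t)"
    by (intro tendsto_Lim) auto
  have le: "(INF t. \<Phi> t) \<le> \<Phi> t" "\<Phi> t \<le> (SUP t. \<Phi> t)" for t
    using bdd by (auto intro: cINF_lower cSUP_upper)
  then have "(INF t. \<Phi> t) \<le> (SUP t. \<Phi> t)" by (meson order_trans)
  fix s t :: ereal assume "s \<le> t"
  then show "ext_lim \<Phi> s \<le> ext_lim \<Phi> t"
    using le \<open>(INF t. \<Phi> t) \<le> (SUP t. \<Phi> t)\<close> assms(2)
    by (cases s; cases t) (auto simp: ext_lim_def top bot mono_def)
qed

lemma ereal_Rats_dense:
  fixes s t :: ereal
  assumes "s < t"
  obtains q where "q \<in> \<rat>" "s < ereal q" "ereal q < t"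
proof -
  obtain a where a: "s < ereal a" "ereal a < t" using ereal_dense2[OF assms] by blast
  obtain b where b: "ereal a < ereal b" "ereal b < t" using ereal_dense2[OF a(2)] by blast
  obtain q where "q \<in> \<rat>" "a < q" "q < b" using Rats_dense_in_real[of a b] b by auto
  then show ?thesis
    using a b by (intro that[of q]) (auto intro: less_trans[of s "ereal a"] less_trans[of _ "ereal b" t])
qed

text \<open>The cut lies just above the essential infimum.\<close>

lemma not_AE_const_cut:
  fixes v :: "'a \<Rightarrow> ereal"
  assumes "\<not> (\<exists>c. AE y in M. v y = c)"
  obtains p c q :: real where "c \<in> \<rat>" "p < c" "c < q"
    "\<not> (AE y in M. ereal p \<le> v y)" "\<not> (AE y in M. v y \<le> ereal q)"
proof -
  \<comment> \<open>\<open>s\<close> becomes the essential infimum of \<open>v\<close>. As the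
    supremum of \<open>T\<close> is reached along a sequence, only countably many null sets are
    discarded to get \<open>s\<close> as a lower bound almost everywhere.\<close>
  define T where "T = {t. AE y in M. t \<le> v y}"
  define s where "s = Sup T"
  have "- \<infinity> \<in> T" by (simp add: T_def)
  then obtain f :: "nat \<Rightarrow> ereal" where f: "range f \<subseteq> T" "s = (SUP i. f i)"
    using Sup_countable_SUP[of T] by (auto simp: s_def)
  have "AE y in M. \<forall>i. f i \<le> v y"
    using f(1) by (auto simp: AE_all_countable T_def)
  then have low: "AE y in M. s \<le> v y"
    by eventually_elim (auto simp: f(2) SUP_le_iff)
  \<comment> \<open>If every rational above \<open>s\<close> bounded \<open>v\<close> from above
    almost everywhere, countably many null sets could be discarded together and \<open>v\<close>
    would equal \<open>s\<close> almost everywhere.\<close>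
  obtain q where q: "q \<in> \<rat>" "s < ereal q" "\<not> (AE y in M. v y \<le> ereal q)"
  proof (rule ccontr)
    assume "\<not> thesis"
    then have "\<forall>q\<in>{q\<in>\<rat>. s < ereal q}. AE y in M. v y \<le> ereal q"
      using that by blast
    then have "AE y in M. \<forall>q\<in>{q\<in>\<rat>. s < ereal q}. v y \<le> ereal q"
      by (subst AE_ball_countable) (auto intro: countable_subset[OF _ countable_rat])
    with low have "AE y in M. v y = s"
    proof eventually_elim
      fix y assume y: "s \<le> v y" "\<forall>q\<in>{q\<in>\<rat>. s < ereal q}. v y \<le> ereal q"
      then show "v y = s"
        by (metis (mono_tags, lifting) ereal_Rats_dense leD mem_Collect_eq order.not_eq_order_implies_strict)
    qed
    then show False using assms by blast
  qed
  \<comment> \<open>\<open>c\<close> is rational because it will index the cover. \<open>p\<close>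
    still exceeds \<open>s\<close>, hence is no essential lower bound.\<close>
  obtain c where c: "c \<in> \<rat>" "s < ereal c" "ereal c < ereal q" using ereal_Rats_dense[OF q(2)] by blast
  obtain p where p: "s < ereal p" "ereal p < ereal c" using ereal_Rats_dense[OF c(2)] by blast
  have "ereal p \<notin> T"
    using p(1) Sup_upper[of "ereal p" T] by (auto simp: s_def)
  then show ?thesis
    using c p q by (intro that[of c p q]) (auto simp: T_def)
qed

text \<open>\<open>u\<close> is only Lebesgue measurable, so measurability of its blowups rests on
  preimages of Lebesgue sets, not just of Borel sets. The coordinatewise scaling with constant
  factor \<open>r\<close> is rewritten as a homothety.\<close>

lemma affine_measurable_lebesgue:
  fixes x :: "'a::euclidean_space"
  assumes "r \<noteq> 0"
  shows "(\<lambda>y. x + r *\<^sub>R y) \<in> lebesgue \<rightarrow>\<^sub>M lebesgue"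
  using lebesgue_affine_measurable[of "\<lambda>_. r" x] assms
  unfolding scaleR_scaleR[symmetric] scaleR_sum_right[symmetric] euclidean_representation .

section \<open>Points with two contrasting densities at all small scales\<close>

text \<open>Both balls have radius \<rho>, so the one displaced by \<alpha> from one point can be
  compared with the one displaced by \<beta> from another. The fixed threshold \<open>R\<close>
  makes the density bounds uniform over the set.\<close>

definition split_points :: "'a::euclidean_space set \<Rightarrow> 'a \<Rightarrow> 'a \<Rightarrow> real \<Rightarrow> 'a set" where
  "split_points U \<alpha> \<beta> R = {x. \<forall>\<rho>. 0 < \<rho> \<longrightarrow> \<rho> < R \<longrightarrow>
     measure lebesgue (U \<inter> ball (x + \<rho> *\<^sub>R \<alpha>) \<rho>) \<le> measure lebesgue (ball (0::'a) \<rho>) / 4 \<and>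
     measure lebesgue (- U \<inter> ball (x + \<rho> *\<^sub>R \<beta>) \<rho>) \<le> measure lebesgue (ball (0::'a) \<rho>) / 4}"

text \<open>Otherwise the \<beta>-ball of \<open>y\<close> nearly coincides with the \<alpha>-ball
  of \<open>x\<close>. Then \<open>U\<close> takes up at most 1/4 + 1/4 of the former and its
  complement at most 1/4, which does not add up to the whole ball.\<close>

lemma split_points_avoid:
  fixes U :: "'a::euclidean_space set"
  assumes U: "U \<in> sets lebesgue" and x: "x \<in> split_points U \<alpha> \<beta> R" and y: "y \<in> split_points U \<alpha> \<beta> R"
    and \<rho>: "0 < \<rho>" "\<rho> < R"
  shows "1 / (4 * real DIM('a)) * \<rho> < norm (x - y - \<rho> *\<^sub>R (\<beta> - \<alpha>))"
proof (rule ccontr)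
  assume neg: "\<not> ?thesis"
  let ?\<mu> = "measure lebesgue" and ?Z = "ball (y + \<rho> *\<^sub>R \<beta>) \<rho>"
  have "dist (y + \<rho> *\<^sub>R \<beta>) (x + \<rho> *\<^sub>R \<alpha>) = norm (x - y - \<rho> *\<^sub>R (\<beta> - \<alpha>))"
    by (simp add: dist_commute dist_norm algebra_simps)
  then have "?\<mu> (U \<inter> ?Z) \<le> ?\<mu> (U \<inter> ball (x + \<rho> *\<^sub>R \<alpha>) \<rho>) + ?\<mu> (ball (0::'a) \<rho>) / 4"
    using neg U \<rho> by (intro measure_Int_ball_translate) auto
  moreover have "?\<mu> (U \<inter> ball (x + \<rho> *\<^sub>R \<alpha>) \<rho>) \<le> ?\<mu> (ball (0::'a) \<rho>) / 4"
    "?\<mu> (- U \<inter> ?Z) \<le> ?\<mu> (ball (0::'a) \<rho>) / 4"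
    using x y \<rho> by (auto simp: split_points_def)
  moreover have "?\<mu> ?Z \<le> ?\<mu> (U \<inter> ?Z) + ?\<mu> (- U \<inter> ?Z)"
  proof -
    have "(U \<inter> ?Z) \<union> (- U \<inter> ?Z) = ?Z" by blast
    moreover have "- U \<in> sets lebesgue"
      using sets.compl_sets[OF U] by (simp add: Compl_eq_Diff_UNIV)
    then have "U \<inter> ?Z \<in> sets lebesgue" "- U \<inter> ?Z \<in> sets lebesgue"
      using U by auto
    ultimately show ?thesis
      using measure_Un_le[of "U \<inter> ?Z" lebesgue "- U \<inter> ?Z"] by simp
  qed
  moreover have "?\<mu> ?Z = ?\<mu> (ball (0::'a) \<rho>)" "0 < ?\<mu> (ball (0::'a) \<rho>)"
    using \<rho> by (simp_all add: content_ball)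
  ultimately show False by linarith
qed

text \<open>Avoidance is known only for \<rho> below \<open>R\<close>. Cutting the set into pieces
  of small diameter settles larger \<rho>, since \<open>\<rho> *\<^sub>R w\<close> is then too long
  to be close to \<open>x - y\<close>.\<close>

lemma split_points_covered:
  fixes U :: "(real ^ 'n) set"
  assumes U: "U \<in> sets lebesgue" and "0 < R"
  shows "\<exists>\<G>. countable \<G> \<and> (\<forall>G\<in>\<G>. lipschitz_graph G) \<and> split_points U \<alpha> \<beta> R \<subseteq> \<Union>\<G>"
proof (cases "split_points U \<alpha> \<beta> R = {}")
  case True
  then show ?thesis by (intro exI[of _ "{}"]) auto
next
  case False
  define w where "w = \<beta> - \<alpha>"
  define \<delta> where "\<delta> = 1 / (4 * real DIM(real ^ 'n))"
  have "0 < \<delta>" by (simp add: \<delta>_def)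
  have avoid: "\<delta> * \<rho> < norm (x - y - \<rho> *\<^sub>R w)"
    if "x \<in> split_points U \<alpha> \<beta> R" "y \<in> split_points U \<alpha> \<beta> R" "0 < \<rho>" "\<rho> < R" for x y \<rho>
    using split_points_avoid[OF U that] by (simp add: w_def \<delta>_def)
  \<comment> \<open>Avoidance applied to a point and itself; in particular \<alpha> and \<beta>
    differ.\<close>
  have \<delta>w: "\<delta> < norm w"
    using False avoid[of _ _ "R / 2"] \<open>0 < R\<close> by fastforce
  \<comment> \<open>Two points of a ball of radius \<kappa> are less than
    \<open>R * (norm w - \<delta>)\<close> apart, exactly what the case of \<rho> at least
    \<open>R\<close> uses.\<close>
  define \<kappa> where "\<kappa> = R * (norm w - \<delta>) / 2"
  have "0 < \<kappa>" using \<delta>w \<open>0 < R\<close> by (simp add: \<kappa>_def)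
  obtain D :: "(real ^ 'n) set" where D: "countable D" "\<And>X. open X \<Longrightarrow> X \<noteq> {} \<Longrightarrow> \<exists>d\<in>D. d \<in> X"
    by (rule countable_dense_setE) blast
  let ?P = "\<lambda>d. split_points U \<alpha> \<beta> R \<inter> ball d \<kappa>"
  have "\<exists>G. lipschitz_graph G \<and> ?P d \<subseteq> G" for d
  proof (rule avoiding_cone_imp_subset_lipschitz_graph)
    show "w \<noteq> 0" "0 < \<delta>" using \<delta>w \<open>0 < \<delta>\<close> by auto
    fix x y and \<rho> :: real assume xy: "x \<in> ?P d" "y \<in> ?P d" and "0 < \<rho>"
    show "\<delta> * \<rho> < norm (x - y - \<rho> *\<^sub>R w)"
    proof (cases "\<rho> < R")
      case True
      with xy \<open>0 < \<rho>\<close> avoid show ?thesis by blast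
    next
      case False
      have "norm (x - y) < R * (norm w - \<delta>)"
        using xy dist_triangle[of x y d] by (auto simp: dist_norm[symmetric] dist_commute \<kappa>_def)
      also have "\<dots> \<le> \<rho> * (norm w - \<delta>)"
        using False \<delta>w by (intro mult_right_mono) auto
      finally show ?thesis
        using norm_triangle_ineq2[of "\<rho> *\<^sub>R w" "x - y"] \<open>0 < \<rho>\<close>
        by (simp add: norm_minus_commute algebra_simps)
    qed
  qed
  then obtain G where G: "\<And>d. lipschitz_graph (G d)" "\<And>d. ?P d \<subseteq> G d" by metis
  have "split_points U \<alpha> \<beta> R \<subseteq> \<Union>(G ` D)"
  proof
    fix x assume "x \<in> split_points U \<alpha> \<beta> R"
    moreover obtain d where "d \<in> D" "d \<in> ball x \<kappa>" using D(2)[of "ball x \<kappa>"] \<open>0 < \<kappa>\<close> by auto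
    ultimately show "x \<in> \<Union>(G ` D)" using G(2)[of d] by (auto simp: dist_commute)
  qed
  with D(1) G(1) show ?thesis by (intro exI[of _ "G ` D"]) auto
qed

section \<open>From the blowup limit to densities of \<open>u\<close>\<close>

text \<open>The ball of radius \<open>1 / m\<close> about \<open>a\<close> in the blowup at scale \<open>\<rho> * m\<close> is the ball of radius
  \<open>\<rho>\<close> about \<open>x + \<rho> *\<^sub>R (m *\<^sub>R a)\<close>; this normalisation makes balls of different radii comparable.\<close>

lemma measure_Int_ball_blowup:
  fixes a x :: "'a::euclidean_space"
  assumes "0 < m" "0 < \<rho>"
  shows "measure lebesgue (S \<inter> ball (x + \<rho> *\<^sub>R (m *\<^sub>R a)) \<rho>)
    = (\<rho> * m) ^ DIM('a) * measure lebesgue {y \<in> ball a (1 / m). x + (\<rho> * m) *\<^sub>R y \<in> S}"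
proof -
  let ?h = "\<lambda>y. (\<rho> * m) *\<^sub>R y + x"
  have "?h ` {y \<in> ball a (1 / m). x + (\<rho> * m) *\<^sub>R y \<in> S} = S \<inter> ball (x + \<rho> *\<^sub>R (m *\<^sub>R a)) \<rho>"
  proof (intro equalityI subsetI)
    have dist: "dist (x + \<rho> *\<^sub>R (m *\<^sub>R a)) (?h y) = (\<rho> * m) * dist a y" for y
    proof -
      have "x + \<rho> *\<^sub>R (m *\<^sub>R a) - ?h y = (\<rho> * m) *\<^sub>R (a - y)" by (simp add: algebra_simps)
      then show ?thesis using assms by (simp add: dist_norm)
    qed
    {
      fix z assume "z \<in> ?h ` {y \<in> ball a (1 / m). x + (\<rho> * m) *\<^sub>R y \<in> S}"
      then show "z \<in> S \<inter> ball (x + \<rho> *\<^sub>R (m *\<^sub>R a)) \<rho>"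
        using assms dist by (auto simp: add.commute field_simps)
    next
      fix z assume z: "z \<in> S \<inter> ball (x + \<rho> *\<^sub>R (m *\<^sub>R a)) \<rho>"
      define y where "y = (z - x) /\<^sub>R (\<rho> * m)"
      have hy: "z = ?h y" using assms unfolding y_def by (simp del: inverse_mult_distrib)
      moreover have "dist a y < 1 / m"
        using z dist[of y] assms unfolding hy[symmetric] by (simp add: field_simps)
      ultimately show "z \<in> ?h ` {y \<in> ball a (1 / m). x + (\<rho> * m) *\<^sub>R y \<in> S}"
        using z by (auto simp: add.commute)
    }
  qed
  then show ?thesis
    using measure_lebesgue_affine[of "\<rho> * m" x "{y \<in> ball a (1 / m). x + (\<rho> * m) *\<^sub>R y \<in> S}"] assms
    by simp
qed

text \<open>\<open>N\<close> plays the set where convergence fails. The part of the ball outside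
  \<open>A\<close> and the set \<open>N\<close> contribute one eighth each, hence the quarter;
  scaling by \<open>\<rho> * m\<close> turns the ball into one of radius \<rho>.\<close>

lemma measure_Int_ball_blowup_le:
  fixes a x :: "'a::euclidean_space"
  assumes "0 < m" "0 < \<rho>" and A: "A \<in> sets lebesgue" and N: "N \<in> lmeasurable"
    and "measure lebesgue (ball a (1 / m) - A) \<le> 1/8 * measure lebesgue (ball a (1 / m))"
    and "measure lebesgue N \<le> 1/8 * measure lebesgue (ball a (1 / m))"
    and S: "S \<in> sets lebesgue" and out: "\<And>y. y \<in> A \<Longrightarrow> y \<in> ball a (1 / m) \<Longrightarrow> x + (\<rho> * m) *\<^sub>R y \<in> S \<Longrightarrow> y \<in> N"
  shows "measure lebesgue (S \<inter> ball (x + \<rho> *\<^sub>R (m *\<^sub>R a)) \<rho>) \<le> measure lebesgue (ball (0::'a) \<rho>) / 4"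
proof -
  let ?B = "ball a (1 / m)"
  have "{y. x + (\<rho> * m) *\<^sub>R y \<in> S} \<in> sets lebesgue"
    using measurable_sets[OF affine_measurable_lebesgue S, of "\<rho> * m" x] assms(1,2) by (simp add: vimage_def)
  then have "measure lebesgue {y \<in> ?B. x + (\<rho> * m) *\<^sub>R y \<in> S} \<le> measure lebesgue ((?B - A) \<union> N)"
    using A N out
    by (intro measure_mono_fmeasurable) (auto simp: Collect_conj_eq intro!: fmeasurable.Un fmeasurable_Diff)
  also have "\<dots> \<le> measure lebesgue (?B - A) + measure lebesgue N"
    using A N by (intro measure_Un_le) auto
  also have "\<dots> \<le> measure lebesgue ?B / 4"
    using assms(5,6) by simp
  finally have "(\<rho> * m) ^ DIM('a) * measure lebesgue {y \<in> ?B. x + (\<rho> * m) *\<^sub>R y \<in> S}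
      \<le> (\<rho> * m) ^ DIM('a) * (measure lebesgue ?B / 4)"
    using assms(1,2) by (intro mult_left_mono) auto
  also have "\<dots> = measure lebesgue (ball (0::'a) \<rho>) / 4"
    using assms(1,2) by (simp add: content_ball power_divide power_mult_distrib)
  finally show ?thesis
    unfolding measure_Int_ball_blowup[OF assms(1,2)] .
qed

lemma not_AE_imp_measure_pos:
  assumes "B \<in> lmeasurable" "{y \<in> B. \<not> P y} \<in> sets lebesgue" "\<not> (AE y in lebesgue_on B. P y)"
  shows "{y \<in> B. \<not> P y} \<in> lmeasurable" "0 < measure lebesgue {y \<in> B. \<not> P y}"
proof -
  let ?N = "{y \<in> B. \<not> P y}"
  show N: "?N \<in> lmeasurable"
    using assms(1,2) by (intro fmeasurableI2[of B lebesgue ?N]) auto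
  have "emeasure (lebesgue_on B) ?N \<noteq> 0"
    using assms AE_iff_measurable[of ?N "lebesgue_on B" P] by (auto simp: sets_restrict_space_iff fmeasurableD)
  then have "emeasure lebesgue ?N \<noteq> 0"
    using assms(1) by (simp add: emeasure_restrict_space fmeasurableD subset_iff)
  then show "0 < measure lebesgue ?N"
    using N by (simp add: emeasure_eq_measure2 zero_less_measure_iff)
qed

text \<open>The sets where \<open>v\<close> is below \<open>p\<close> and above \<open>q\<close>
  each fill more than seven eighths of some ball. Strict monotonicity of \<Phi> turns the gaps
  around \<open>c\<close> into a fixed \<epsilon>, so convergence in measure carries both densities
  over to \<open>u\<close> at all small scales.\<close>

lemma jump_set_split_points:
  fixes \<Phi> :: "real \<Rightarrow> real" and u :: "real ^ 'n \<Rightarrow> ereal"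
  assumes \<Phi>: "bounded (range \<Phi>)" "continuous_on UNIV \<Phi>" "strict_mono \<Phi>"
    and u: "u \<in> borel_measurable lebesgue"
    and D: "\<And>X. open X \<Longrightarrow> X \<noteq> {} \<Longrightarrow> \<exists>d\<in>D. d \<in> X"
    and x: "x \<in> jump_set \<Phi> u"
  obtains c a b m l k where "c \<in> \<rat>" "a \<in> D" "b \<in> D"
    "x \<in> split_points {z. ereal c \<le> u z} (real m *\<^sub>R a) (real l *\<^sub>R b) (1 / real (Suc k))"
proof -
  let ?\<mu> = "measure lebesgue" and ?E = "ext_lim \<Phi>" and ?B1 = "ball (0::real ^ 'n) 1"
  obtain v :: "real ^ 'n \<Rightarrow> ereal" where v: "v \<in> borel_measurable (lebesgue_on ?B1)"
    and conv: "converges_in_B1 \<Phi> (blowup u x) v"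
    and nonconst: "\<not> (\<exists>c. AE y in lebesgue_on ?B1. v y = c)"
    using x by (auto simp: jump_set_def)
  obtain p c q where c: "c \<in> \<rat>" "p < c" "c < q" and
    p: "\<not> (AE y in lebesgue_on ?B1. ereal p \<le> v y)" and q: "\<not> (AE y in lebesgue_on ?B1. v y \<le> ereal q)"
    using not_AE_const_cut[OF nonconst] by metis
  have meas: "{y \<in> ?B1. P y} \<in> sets lebesgue" if "Measurable.pred (lebesgue_on ?B1) P" for P
    using that by (simp add: pred_def sets_restrict_space_iff)
  define A where "A = {y \<in> ?B1. \<not> ereal p \<le> v y}"
  define B where "B = {y \<in> ?B1. \<not> v y \<le> ereal q}"
  have A: "A \<in> lmeasurable" "0 < ?\<mu> A" and B: "B \<in> lmeasurable" "0 < ?\<mu> B"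
    unfolding A_def B_def using p q v
    by (intro not_AE_imp_measure_pos meas; simp; measurable)+
  obtain a m where a: "a \<in> D" "0 < (m::nat)" "ball a (1 / m) \<subseteq> ?B1"
    "?\<mu> (ball a (1 / m) - A) < 1/8 * ?\<mu> (ball a (1 / m))"

  proof (rule density_ball[OF A, of ?B1 D "1/8"])
    show "A \<subseteq> ?B1" by (auto simp: A_def)
  qed (use D that in auto)
  obtain b l where b: "b \<in> D" "0 < (l::nat)" "ball b (1 / l) \<subseteq> ?B1"
    "?\<mu> (ball b (1 / l) - B) < 1/8 * ?\<mu> (ball b (1 / l))"

  proof (rule density_ball[OF B, of ?B1 D "1/8"])
    show "B \<subseteq> ?B1" by (auto simp: B_def)
  qed (use D that in auto)
  have mono: "?E s \<le> ?E t" if "s \<le> t" for s t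
    using ext_lim_mono[OF \<Phi>(1) strict_mono_mono[OF \<Phi>(3)]] that by (rule monoD)
  have ext_lim_ereal: "?E (ereal t) = \<Phi> t" for t by (simp add: ext_lim_def)
  have gap: "\<Phi> p < \<Phi> c" "\<Phi> c < \<Phi> q" using \<Phi>(3) c by (auto simp: strict_mono_def)
  \<comment> \<open>Smaller than both gaps of \<Phi> around \<open>c\<close>: where the blowup lies
    on the wrong side of \<open>c\<close> at a point of \<open>A\<close> or \<open>B\<close>, its
    image under \<Phi> differs from that of \<open>v\<close> by more than \<epsilon>, so the point
    falls into \<open>N\<close>.\<close>
  define \<epsilon> where "\<epsilon> = min (\<Phi> c - \<Phi> p) (\<Phi> q - \<Phi> c) / 2"
  have \<epsilon>: "0 < \<epsilon>" "\<epsilon> < \<Phi> c - \<Phi> p" "\<epsilon> < \<Phi> q - \<Phi> c" using gap by (auto simp: \<epsilon>_def)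
  define N where "N r = {y \<in> ?B1. \<bar>?E (blowup u x r y) - ?E (v y)\<bar> > \<epsilon>}" for r
  have N: "N r \<in> lmeasurable" if "0 < r" for r
  proof (rule fmeasurableI2[of ?B1])
    have [measurable]: "v \<in> borel_measurable (lebesgue_on ?B1)" by (rule v)
    have [measurable]: "blowup u x r \<in> borel_measurable (lebesgue_on ?B1)"
      unfolding blowup_def using that
      by (intro measurable_restrict_space1 measurable_compose[OF affine_measurable_lebesgue u]) auto
    note ext_lim_measurable[OF \<Phi>(2), measurable]
    show "N r \<in> sets lebesgue" unfolding N_def by (intro meas) measurable
  qed (auto simp: N_def)
  \<comment> \<open>The smaller of the two balls sets the bound, so that one \<open>r0\<close>
    serves both.\<close>
  define \<eta> where "\<eta> = 1/8 * min (?\<mu> (ball a (1 / m))) (?\<mu> (ball b (1 / l)))"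
  have "0 < \<eta>" using a b by (simp add: \<eta>_def)
  have "((\<lambda>r. ?\<mu> (N r)) \<longlongrightarrow> 0) (at_right 0)"
    using conv \<epsilon>(1) unfolding converges_in_B1_def N_def by blast
  then have "\<forall>\<^sub>F r in at_right 0. ?\<mu> (N r) < \<eta>"
    using \<open>0 < \<eta>\<close> by (rule order_tendstoD)
  then obtain r0 where r0: "0 < r0" "\<And>r. 0 < r \<Longrightarrow> r < r0 \<Longrightarrow> ?\<mu> (N r) < \<eta>"
    by (auto simp: eventually_at_right_field)
  \<comment> \<open>The two balls of radius \<rho> come from different blowup scales,
    \<open>\<rho> * m\<close> and \<open>\<rho> * l\<close>; this choice keeps both below
    \<open>r0\<close>.\<close>
  obtain k where k: "1 / real (Suc k) < min (r0 / m) (r0 / l)"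
    using nat_approx_posE[of "min (r0 / m) (r0 / l)"] r0 a b by auto
  define U where "U = {z. ereal c \<le> u z}"
  have U: "U \<in> sets lebesgue" 
    using measurable_sets[OF u, of "{ereal c..}"] by (simp add: vimage_def U_def)
  then have U': "- U \<in> sets lebesgue"
    using sets.compl_sets by (fastforce simp: Compl_eq_Diff_UNIV)
  have "x \<in> split_points U (real m *\<^sub>R a) (real l *\<^sub>R b) (1 / real (Suc k))"
    unfolding split_points_def
  proof (intro CollectI allI impI conjI)
    fix \<rho> :: real assume \<rho>: "0 < \<rho>" "\<rho> < 1 / real (Suc k)"
    have "\<rho> < r0 / m" "\<rho> < r0 / l"
      using \<rho>(2) k by linarith+
    then have rm: "0 < \<rho> * m" "\<rho> * m < r0" and rl: "0 < \<rho> * l" "\<rho> * l < r0"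
      using \<rho>(1) a(2) b(2) by (simp_all add: pos_less_divide_eq)
    show "?\<mu> (U \<inter> ball (x + \<rho> *\<^sub>R (real m *\<^sub>R a)) \<rho>) \<le> ?\<mu> (ball (0::real ^ 'n) \<rho>) / 4"
    proof (rule measure_Int_ball_blowup_le[where A = A and N = "N (\<rho> * m)"])
      fix y assume y: "y \<in> A" "y \<in> ball a (1 / real m)" "x + (\<rho> * real m) *\<^sub>R y \<in> U"
      then have "\<Phi> c \<le> ?E (blowup u x (\<rho> * m) y)" "?E (v y) \<le> \<Phi> p"
        using mono[of "ereal c" "blowup u x (\<rho> * m) y"] mono[of "v y" "ereal p"]
        by (simp_all add: ext_lim_ereal U_def A_def blowup_def not_le less_imp_le)
      then show "y \<in> N (\<rho> * m)" using y(1) \<epsilon> by (auto simp: N_def A_def)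
    qed (use a(2,4) \<rho>(1) A(1) U N[OF rm(1)] r0(2)[OF rm] in \<open>simp_all add: \<eta>_def fmeasurableD\<close>)
    show "?\<mu> (- U \<inter> ball (x + \<rho> *\<^sub>R (real l *\<^sub>R b)) \<rho>) \<le> ?\<mu> (ball (0::real ^ 'n) \<rho>) / 4"
    proof (rule measure_Int_ball_blowup_le[where A = B and N = "N (\<rho> * l)"])
      fix y assume y: "y \<in> B" "y \<in> ball b (1 / real l)" "x + (\<rho> * real l) *\<^sub>R y \<in> - U"
      then have "?E (blowup u x (\<rho> * l) y) \<le> \<Phi> c" "\<Phi> q \<le> ?E (v y)"
        using mono[of "blowup u x (\<rho> * l) y" "ereal c"] mono[of "ereal q" "v y"]
        by (simp_all add: ext_lim_ereal U_def B_def blowup_def not_le less_imp_le)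
      then show "y \<in> N (\<rho> * l)" using y(1) \<epsilon> by (auto simp: N_def B_def)
    qed (use b(2,4) \<rho>(1) B(1) U' N[OF rl(1)] r0(2)[OF rl] in \<open>simp_all add: \<eta>_def fmeasurableD\<close>)
  qed
  then show ?thesis
    using c a b by (intro that[of c a b m l k]) (auto simp: U_def)
qed

section \<open>Union over countably many parameters\<close>

theorem mainTheorem2:
  fixes \<Phi> :: "real \<Rightarrow> real" and u :: "real ^ 'n \<Rightarrow> ereal"
  assumes "bounded (range \<Phi>)" and "continuous_on UNIV \<Phi>" and "strict_mono \<Phi>"
    and "u \<in> borel_measurable lebesgue"
  shows "\<exists>\<G>. countable \<G> \<and> (\<forall>G\<in>\<G>. lipschitz_graph G) \<and> jump_set \<Phi> u \<subseteq> \<Union>\<G>"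
proof -
  obtain D :: "(real ^ 'n) set" where D: "countable D" "\<And>X. open X \<Longrightarrow> X \<noteq> {} \<Longrightarrow> \<exists>d\<in>D. d \<in> X"
    by (rule countable_dense_setE) blast
  \<comment> \<open>All data extracted at a jump point are countable: a rational cut, two centres in
    \<open>D\<close>, two inverse radii and the threshold index \<open>k\<close>.\<close>
  define I :: "(real \<times> (real ^ 'n) \<times> (real ^ 'n) \<times> nat \<times> nat \<times> nat) set"
    where "I = \<rat> \<times> D \<times> D \<times> UNIV"
  define S where "S = (\<lambda>(c, a, b, m, l, k).
    split_points {z. ereal c \<le> u z} (real m *\<^sub>R a) (real l *\<^sub>R b) (1 / real (Suc k)))"
  have meas: "{z. ereal c \<le> u z} \<in> sets lebesgue" for c
    using measurable_sets[OF assms(4), of "{ereal c..}"] by (simp add: vimage_def)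
  \<comment> \<open>The covering holds for arbitrary offsets, so tuples with \<open>m = 0\<close> or
    \<open>l = 0\<close> may stay in the index set.\<close>
  have "\<exists>\<G>. countable \<G> \<and> (\<forall>G\<in>\<G>. lipschitz_graph G) \<and> S i \<subseteq> \<Union>\<G>" for i
    unfolding S_def by (cases i) (auto intro!: split_points_covered meas simp del: of_nat_Suc)
  then obtain \<G> where \<G>: "\<And>i. countable (\<G> i)" "\<And>i G. G \<in> \<G> i \<Longrightarrow> lipschitz_graph G" "\<And>i. S i \<subseteq> \<Union>(\<G> i)"
    by metis
  have "countable (\<Union>i\<in>I. \<G> i)"
    using D(1) \<G>(1) by (auto simp: I_def countable_rat)
  moreover have "jump_set \<Phi> u \<subseteq> \<Union>(\<Union>i\<in>I. \<G> i)"
  proof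
    fix x assume "x \<in> jump_set \<Phi> u"
    then obtain c a b m l k where "c \<in> \<rat>" "a \<in> D" "b \<in> D" and
      x: "x \<in> split_points {z. ereal c \<le> u z} (real m *\<^sub>R a) (real l *\<^sub>R b) (1 / real (Suc k))"
      using jump_set_split_points[OF assms D(2)] by metis
    then have "(c, a, b, m, l, k) \<in> I" "x \<in> S (c, a, b, m, l, k)"
      by (simp_all add: I_def S_def)
    then show "x \<in> \<Union>(\<Union>i\<in>I. \<G> i)" using \<G>(3) by blast
  qed
  ultimately show ?thesis using \<G>(2) by (intro exI[of _ "\<Union>i\<in>I. \<G> i"]) auto
qed

end
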